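(* Let $a \geq 0$ and $t > 0$. Suppose $X$ is a continuous real random variable whose moment generating function is finite at $t$, and which has a density that is decreasing over $[a - 1/t, a + 1/t]$. Then $$\mathbb{P}(X \geq a) \leq \tfrac12 \operatorname{mgf}_X(t)\exp(-ta).$$
   Context: The moment generating function of $X$ at $t$ is $\operatorname{mgf}_X(t) = \mathbb{E}[\exp(tX)]$. A continuous random variable is a real random variable whose distribution has a density with respect to Lebesgue measure. "Decreasing" is understood in the weak sense (nonincreasing). *)

theory Defs
  imports "HOL-Probability.Probability"
begin

(* The Bochner integral is 0 for non-integrable functions, so finiteness of the
   moment generating function at t has to be expressed by mgf_finite, not through mgf. *)

definition mgf :: "'a measure \<Rightarrow> ('a \<Rightarrow> real) \<Rightarrow> real \<Rightarrow> real" where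
  "mgf M X t = (\<integral>\<omega>. exp (t * X \<omega>) \<partial>M)"

definition mgf_finite :: "'a measure \<Rightarrow> ('a \<Rightarrow> real) \<Rightarrow> real \<Rightarrow> bool" where
  "mgf_finite M X t \<longleftrightarrow> integrable M (\<lambda>\<omega>. exp (t * X \<omega>))"

end

theory Submission
  imports Defs
begin

text \<open>
  Let \<open>D x = f x * (exp (t * (x - a)) - 2 * indicator {a..} x)\<close>. After passing from \<open>X\<close> to its
  density, twice the difference of the two sides of the claimed bound is the integral of \<open>D\<close> over
  the line, so it has to be shown that this integral is nonnegative.
  Although \<open>D\<close> itself may be negative just to the right of \<open>a\<close>, the symmetrised
  integrand \<open>D x + D (2 * a - x)\<close>, which has twice the integral of \<open>D\<close>, is nonnegative for every
  \<open>x \<noteq> a\<close> (\<open>reflected_exp_weight_ge\<close>), and this suffices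
  (\<open>integral_nonneg_if_reflection_sum_nonneg\<close>). By symmetry let \<open>x > a\<close> and \<open>u = t * (x - a)\<close>; the sum is then
  \<open>f x * (exp u - 2) + f (2 * a - x) * exp (- u)\<close>.
  If \<open>u \<le> 1\<close>, both points lie in the interval on which \<open>f\<close> decreases, so the sum is at least
  \<open>f x * (exp u + exp (- u) - 2)\<close>, and \<open>exp u + exp (- u) \<ge> 2\<close>; if \<open>u \<ge> 1\<close>, already
  \<open>exp u \<ge> 1 + u \<ge> 2\<close>.
\<close>

text \<open>
  The reflected pair of points carries enough exponential weight to dominate twice the mass of
  the right-hand point: near \<open>a\<close> by monotonicity of \<open>f\<close>, far from \<open>a\<close> by the right-hand point alone.
\<close>
lemma reflected_exp_weight_ge:
  fixes f :: "real \<Rightarrow> real" and a t x :: real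
  assumes t: "t > 0"
    and nonneg: "\<And>x. f x \<ge> 0"
    and anti: "antimono_on {a - 1 / t .. a + 1 / t} f"
    and x: "x > a"
  shows "2 * f x \<le> f x * exp (t * (x - a)) + f (2 * a - x) * exp (- (t * (x - a)))"
proof (cases "x \<le> a + 1 / t")
  case True
  have "f x \<le> f (2 * a - x)"
    using monotone_onD[OF anti, of "2 * a - x" x] True x by simp
  hence "f x * exp (- (t * (x - a))) \<le> f (2 * a - x) * exp (- (t * (x - a)))"
    by (simp add: mult_right_mono)
  moreover have "2 \<le> exp (t * (x - a)) + exp (- (t * (x - a)))"
    using exp_ge_add_one_self[of "t * (x - a)"] exp_ge_add_one_self[of "- (t * (x - a))"]
    by linarith
  hence "f x * 2 \<le> f x * (exp (t * (x - a)) + exp (- (t * (x - a))))"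
    by (intro mult_left_mono nonneg)
  ultimately show ?thesis
    unfolding distrib_left by linarith
next
  case False
  have "1 \<le> t * (x - a)"
    using False t by (simp add: field_simps)
  hence "2 \<le> exp (t * (x - a))"
    using exp_ge_add_one_self[of "t * (x - a)"] by linarith
  hence "f x * 2 \<le> f x * exp (t * (x - a))"
    by (intro mult_left_mono nonneg)
  moreover have "0 \<le> f (2 * a - x) * exp (- (t * (x - a)))"
    by (simp add: nonneg)
  ultimately show ?thesis
    by linarith
qed

text \<open>
  An integral over the line is unchanged by reflection in \<open>a\<close>, so its sign can be read off from
  the symmetrised integrand.
\<close>
lemma integral_nonneg_if_reflection_sum_nonneg:
  fixes D :: "real \<Rightarrow> real" and a :: real
  assumes int: "integrable lborel D"
    and sum: "AE x in lborel. 0 \<le> D x + D (2 * a - x)"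
  shows "0 \<le> (\<integral>x. D x \<partial>lborel)"
proof -
  have int': "integrable lborel (\<lambda>x. D (2 * a - x))"
    using lborel_integrable_real_affine[OF int, of "- 1" "2 * a"] by simp
  have refl: "(\<integral>x. D (2 * a - x) \<partial>lborel) = (\<integral>x. D x \<partial>lborel)"
    using lborel_integral_real_affine[of "- 1" D "2 * a"] by simp
  have "0 \<le> (\<integral>x. D x + D (2 * a - x) \<partial>lborel)"
    using sum by (rule integral_nonneg_AE)
  also have "\<dots> = 2 * (\<integral>x. D x \<partial>lborel)"
    using int int' refl by simp
  finally show ?thesis by simp
qed

theorem lemma14:
  fixes M :: "'a measure" and X :: "'a \<Rightarrow> real" and f :: "real \<Rightarrow> real" and a t :: real
  assumes "prob_space M"
    and "a \<ge> 0" and "t > 0"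
    and "\<And>x. f x \<ge> 0"
    and "distributed M lborel X (\<lambda>x. ennreal (f x))"
    and "mgf_finite M X t"
    and "antimono_on {a - 1 / t .. a + 1 / t} f"
  shows "measure M {\<omega> \<in> space M. X \<omega> \<ge> a} \<le> 1 / 2 * mgf M X t * exp (- t * a)"
proof -
  interpret prob_space M by fact
  note distr = assms(5)
  have X [measurable]: "X \<in> borel_measurable M"
    using distributed_measurable[OF distr] by simp
  define e where "e x = exp (t * (x - a))" for x
  define H where "H = (indicator {a..} :: real \<Rightarrow> real)"
  define D where "D x = f x * e x - 2 * (f x * H x)" for x
  have [measurable]: "e \<in> borel_measurable borel" "H \<in> borel_measurable borel"
    unfolding e_def H_def by measurable
  have e_X: "e (X \<omega>) = exp (- t * a) * exp (t * X \<omega>)" for \<omega>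
    by (simp add: e_def algebra_simps flip: exp_add)
  have e_int_M: "integrable M (\<lambda>\<omega>. e (X \<omega>))"
    using assms(6) unfolding e_X mgf_finite_def by simp
  have H_X: "H (X \<omega>) = indicator {\<omega> \<in> space M. X \<omega> \<ge> a} \<omega>" if "\<omega> \<in> space M" for \<omega>
    using that by (simp add: H_def indicator_def)
  have H_int_M: "integrable M (\<lambda>\<omega>. H (X \<omega>))"
    by (rule integrable_const_bound[where B = 1]) (auto simp: H_def indicator_def)
  have e_int: "integrable lborel (\<lambda>x. f x * e x)"
    using e_int_M distributed_integrable[OF distr, of e] assms(4) by simp
  have H_int: "integrable lborel (\<lambda>x. f x * H x)"
    using H_int_M distributed_integrable[OF distr, of H] assms(4) by simp
  have e_eq: "(\<integral>x. f x * e x \<partial>lborel) = mgf M X t * exp (- t * a)"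
    using distributed_integral[OF distr, of e] assms(4) unfolding e_X mgf_def by simp
  have "(\<integral>\<omega>. H (X \<omega>) \<partial>M) = (\<integral>\<omega>. indicator {\<omega> \<in> space M. X \<omega> \<ge> a} \<omega> \<partial>M)"
    by (intro Bochner_Integration.integral_cong refl H_X)
  hence H_eq: "(\<integral>x. f x * H x \<partial>lborel) = measure M {\<omega> \<in> space M. X \<omega> \<ge> a}"
    using distributed_integral[OF distr, of H] assms(4) by simp
  have right: "0 \<le> D x + D (2 * a - x)" if "x > a" for x
    using reflected_exp_weight_ge[where f = f, OF assms(3,4,7) that] that
    by (simp add: D_def e_def H_def algebra_simps)
  have sym: "0 \<le> D x + D (2 * a - x)" if "x \<noteq> a" for x
    using right[of x] right[of "2 * a - x"] that by (cases "x > a") (auto simp: add.commute)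
  \<comment> \<open>At \<open>x = a\<close> the sum is \<open>- 2 * f a\<close>, so this single point has to be discarded.\<close>
  have "0 \<le> (\<integral>x. D x \<partial>lborel)"
  proof (rule integral_nonneg_if_reflection_sum_nonneg)
    show "integrable lborel D"
      unfolding D_def using e_int H_int by simp
    show "AE x in lborel. 0 \<le> D x + D (2 * a - x)"
      using AE_lborel_singleton[of a] by eventually_elim (rule sym)
  qed
  also have "(\<integral>x. D x \<partial>lborel)
      = mgf M X t * exp (- t * a) - 2 * measure M {\<omega> \<in> space M. X \<omega> \<ge> a}"
    unfolding D_def using e_int H_int e_eq H_eq by simp
  finally show ?thesis by simp
qed

end
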